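(* Let $\mathcal{C}$ be a congruence-modular equational class, let $A,B,C$ be members of $\mathcal{C}$ and let $f:A\to B$ and $g:B\to C$ be admissible morphisms in $\mathcal{C}$ (so that $g\circ f$ is admissible). Then: (1) if $f$ and $g$ fulfill GU, then $g\circ f$ fulfills GU; (2) if $f$ is surjective and $g$ fulfills LO, then $g\circ f$ fulfills LO; (3) if $f$ and $g$ fulfill LO and $g$ is injective, then $g\circ f$ fulfills LO.
   Context: An equational class (variety) $\mathcal{C}$ of algebras of a fixed type is congruence-modular if the congruence lattice $\mathrm{Con}(M)$ is modular for every member $M$ of $\mathcal{C}$. All algebras are non-empty; a morphism in $\mathcal{C}$ is a homomorphism between members of $\mathcal{C}$. For an algebra $M$, $\Delta_M$ is the equality relation and $\nabla_M=M^2$. In a congruence-modular class, the commutator $[\alpha,\beta]_M$ of $\alpha,\beta\in\mathrm{Con}(M)$ is the (Freese--McKenzie) modular commutator, i.e. the smallest congruence $\delta$ of $M$ such that, for every term $t(\bar x,\bar y)$ and all tuples $\bar a,\bar b,\bar c,\bar d$ of elements of $M$ with $(a_i,b_i)\in\alpha$ for all $i$ and $(c_j,d_j)\in\beta$ for all $j$, $(t(\bar a,\bar c),t(\bar a,\bar d))\in\delta$ implies $(t(\bar b,\bar c),t(\bar b,\bar d))\in\delta$. A congruence $\phi\neq\nabla_M$ is prime if, for all $\alpha,\beta\in\mathrm{Con}(M)$, $[\alpha,\beta]_M\subseteq\phi$ implies $\alpha\subseteq\phi$ or $\beta\subseteq\phi$; $\mathrm{Spec}(M)$ is the set of prime congruences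 of $M$. For a morphism $f:A\to B$ and $\psi\in\mathrm{Con}(B)$, $f^*(\psi)=\{(x,y)\in A^2 : (f(x),f(y))\in\psi\}\in\mathrm{Con}(A)$ and $\mathrm{Ker}(f)=f^*(\Delta_B)$. $f$ is admissible if $f^*(\psi)\in\mathrm{Spec}(A)$ for all $\psi\in\mathrm{Spec}(B)$. An admissible morphism $f:A\to B$ fulfills GU (Going Up) if for all $\phi,\psi\in\mathrm{Spec}(A)$ and $\phi_1\in\mathrm{Spec}(B)$ with $\phi\subseteq\psi$ and $f^*(\phi_1)=\phi$ there is $\psi_1\in\mathrm{Spec}(B)$ with $\phi_1\subseteq\psi_1$ and $f^*(\psi_1)=\psi$; it fulfills LO (Lying Over) if for every $\phi\in\mathrm{Spec}(A)$ with $\mathrm{Ker}(f)\subseteq\phi$ there is $\phi_1\in\mathrm{Spec}(B)$ with $f^*(\phi_1)=\phi$. *)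

theory Defs
  imports Main "HOL.Hull" "HOL-Library.Countable_Set"
begin

section \<open>Algebras, terms and equational classes\<close>

text \<open>
  A type of algebras is given by operation symbols of type \<open>'f\<close> and their finite arities
  \<open>ar :: 'f \<Rightarrow> nat\<close>. Operations are only relevant on argument lists of the right length with entries
  in the carrier, and terms only if every symbol is applied to the right number of arguments.
\<close>

record ('f, 'a) ualg =
  Carrier :: "'a set"
  Op :: "'f \<Rightarrow> 'a list \<Rightarrow> 'a"

definition algebra :: "('f \<Rightarrow> nat) \<Rightarrow> ('f, 'a) ualg \<Rightarrow> bool" where
  "algebra ar M \<longleftrightarrow> Carrier M \<noteq> {} \<and>
     (\<forall>f xs. length xs = ar f \<and> set xs \<subseteq> Carrier M \<longrightarrow> Op M f xs \<in> Carrier M)"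

datatype ('f, 'v) trm = Var 'v | App 'f "('f, 'v) trm list"

primrec wf_trm :: "('f \<Rightarrow> nat) \<Rightarrow> ('f, 'v) trm \<Rightarrow> bool" where
  "wf_trm ar (Var x) = True"
| "wf_trm ar (App f ts) = (length ts = ar f \<and> list_all (wf_trm ar) ts)"

primrec eval :: "('f, 'a) ualg \<Rightarrow> ('v \<Rightarrow> 'a) \<Rightarrow> ('f, 'v) trm \<Rightarrow> 'a" where
  "eval M v (Var x) = v x"
| "eval M v (App f ts) = Op M f (map (eval M v) ts)"

type_synonym 'f identity = "('f, nat) trm \<times> ('f, nat) trm"

definition identities :: "('f \<Rightarrow> nat) \<Rightarrow> 'f identity set \<Rightarrow> bool" where
  "identities ar E \<longleftrightarrow> (\<forall>(s, t) \<in> E. wf_trm ar s \<and> wf_trm ar t)"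

text \<open>The members, with carrier in \<open>'a\<close>, of the equational class axiomatised by \<open>E\<close>.\<close>

definition eq_class :: "('f \<Rightarrow> nat) \<Rightarrow> 'f identity set \<Rightarrow> ('f, 'a) ualg set" where
  "eq_class ar E = {M. algebra ar M \<and>
     (\<forall>(s, t) \<in> E. \<forall>v. range v \<subseteq> Carrier M \<longrightarrow> eval M v s = eval M v t)}"

definition morphism ::
    "('f \<Rightarrow> nat) \<Rightarrow> ('f, 'a) ualg \<Rightarrow> ('f, 'b) ualg \<Rightarrow> ('a \<Rightarrow> 'b) \<Rightarrow> bool" where
  "morphism ar A B h \<longleftrightarrow> h ` Carrier A \<subseteq> Carrier B \<and>
     (\<forall>f xs. length xs = ar f \<and> set xs \<subseteq> Carrier A \<longrightarrow> h (Op A f xs) = Op B f (map h xs))"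


section \<open>Congruences and congruence-modularity\<close>

definition Con :: "('f \<Rightarrow> nat) \<Rightarrow> ('f, 'a) ualg \<Rightarrow> 'a rel set" where
  "Con ar M = {\<theta>. \<theta> \<subseteq> Carrier M \<times> Carrier M \<and> equiv (Carrier M) \<theta> \<and>
     (\<forall>f xs ys. length xs = ar f \<and> list_all2 (\<lambda>x y. (x, y) \<in> \<theta>) xs ys \<longrightarrow>
        (Op M f xs, Op M f ys) \<in> \<theta>)}"

definition Delta :: "('f, 'a) ualg \<Rightarrow> 'a rel" where
  "Delta M = Id_on (Carrier M)"

definition Nabla :: "('f, 'a) ualg \<Rightarrow> 'a rel" where
  "Nabla M = Carrier M \<times> Carrier M"

text \<open>In the lattice of congruences the meet is the intersection.\<close>

definition con_join :: "('f \<Rightarrow> nat) \<Rightarrow> ('f, 'a) ualg \<Rightarrow> 'a rel \<Rightarrow> 'a rel \<Rightarrow> 'a rel" where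
  "con_join ar M \<alpha> \<beta> = (\<lambda>\<theta>. \<theta> \<in> Con ar M) hull (\<alpha> \<union> \<beta>)"

definition modular_Con :: "('f \<Rightarrow> nat) \<Rightarrow> ('f, 'a) ualg \<Rightarrow> bool" where
  "modular_Con ar M \<longleftrightarrow>
     (\<forall>\<alpha> \<in> Con ar M. \<forall>\<beta> \<in> Con ar M. \<forall>\<gamma> \<in> Con ar M. \<alpha> \<subseteq> \<gamma> \<longrightarrow>
        con_join ar M \<alpha> (\<beta> \<inter> \<gamma>) = con_join ar M \<alpha> \<beta> \<inter> \<gamma>)"

text \<open>
  A formula cannot quantify over the members of an equational class on all types, so the members
  are taken in one fixed universe, large enough to contain a copy of every countably generated
  member. By \<open>congruence_modular_member\<close> below this yields modularity of \<open>Con ar M\<close> for the members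
  \<open>M\<close> on every type, so nothing is lost.
\<close>

definition congruence_modular :: "('f \<Rightarrow> nat) \<Rightarrow> 'f identity set \<Rightarrow> bool" where
  "congruence_modular ar E \<longleftrightarrow>
     (\<forall>M \<in> (eq_class ar E :: ('f, ('f, nat) trm set) ualg set). modular_Con ar M)"


section \<open>The commutator and prime congruences\<close>

text \<open>
  The variables of a term \<open>t(x, y)\<close> are split by the sum type. The tuples are given as sequences, of
  which only the finitely many entries whose index occurs in \<open>t\<close> matter.
\<close>

definition centralizes ::
    "('f \<Rightarrow> nat) \<Rightarrow> ('f, 'a) ualg \<Rightarrow> 'a rel \<Rightarrow> 'a rel \<Rightarrow> 'a rel \<Rightarrow> bool" where
  "centralizes ar M \<alpha> \<beta> \<delta> \<longleftrightarrow>
     (\<forall>(t :: ('f, nat + nat) trm) a b c d.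
        wf_trm ar t \<and> (\<forall>i. (a i, b i) \<in> \<alpha>) \<and> (\<forall>j. (c j, d j) \<in> \<beta>) \<longrightarrow>
        (eval M (case_sum a c) t, eval M (case_sum a d) t) \<in> \<delta> \<longrightarrow>
        (eval M (case_sum b c) t, eval M (case_sum b d) t) \<in> \<delta>)"

definition commutator ::
    "('f \<Rightarrow> nat) \<Rightarrow> ('f, 'a) ualg \<Rightarrow> 'a rel \<Rightarrow> 'a rel \<Rightarrow> 'a rel" where
  "commutator ar M \<alpha> \<beta> = \<Inter>{\<delta> \<in> Con ar M. centralizes ar M \<alpha> \<beta> \<delta>}"

definition Spec :: "('f \<Rightarrow> nat) \<Rightarrow> ('f, 'a) ualg \<Rightarrow> 'a rel set" where
  "Spec ar M = {\<phi> \<in> Con ar M. \<phi> \<noteq> Nabla M \<and>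
     (\<forall>\<alpha> \<in> Con ar M. \<forall>\<beta> \<in> Con ar M. commutator ar M \<alpha> \<beta> \<subseteq> \<phi> \<longrightarrow> \<alpha> \<subseteq> \<phi> \<or> \<beta> \<subseteq> \<phi>)}"


section \<open>Admissible morphisms, Going Up and Lying Over\<close>

definition pullback :: "('f, 'a) ualg \<Rightarrow> ('a \<Rightarrow> 'b) \<Rightarrow> 'b rel \<Rightarrow> 'a rel" where
  "pullback A f \<psi> = {(x, y) \<in> Carrier A \<times> Carrier A. (f x, f y) \<in> \<psi>}"

definition Ker :: "('f, 'a) ualg \<Rightarrow> ('f, 'b) ualg \<Rightarrow> ('a \<Rightarrow> 'b) \<Rightarrow> 'a rel" where
  "Ker A B f = pullback A f (Delta B)"

definition admissible ::
    "('f \<Rightarrow> nat) \<Rightarrow> ('f, 'a) ualg \<Rightarrow> ('f, 'b) ualg \<Rightarrow> ('a \<Rightarrow> 'b) \<Rightarrow> bool" where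
  "admissible ar A B f \<longleftrightarrow> morphism ar A B f \<and> (\<forall>\<psi> \<in> Spec ar B. pullback A f \<psi> \<in> Spec ar A)"

definition GU ::
    "('f \<Rightarrow> nat) \<Rightarrow> ('f, 'a) ualg \<Rightarrow> ('f, 'b) ualg \<Rightarrow> ('a \<Rightarrow> 'b) \<Rightarrow> bool" where
  "GU ar A B f \<longleftrightarrow>
     (\<forall>\<phi> \<in> Spec ar A. \<forall>\<psi> \<in> Spec ar A. \<forall>\<phi>1 \<in> Spec ar B.
        \<phi> \<subseteq> \<psi> \<and> pullback A f \<phi>1 = \<phi> \<longrightarrow>
        (\<exists>\<psi>1 \<in> Spec ar B. \<phi>1 \<subseteq> \<psi>1 \<and> pullback A f \<psi>1 = \<psi>))"

definition LO ::
    "('f \<Rightarrow> nat) \<Rightarrow> ('f, 'a) ualg \<Rightarrow> ('f, 'b) ualg \<Rightarrow> ('a \<Rightarrow> 'b) \<Rightarrow> bool" where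
  "LO ar A B f \<longleftrightarrow>
     (\<forall>\<phi> \<in> Spec ar A. Ker A B f \<subseteq> \<phi> \<longrightarrow> (\<exists>\<phi>1 \<in> Spec ar B. pullback A f \<phi>1 = \<phi>))"


section \<open>The definitions are as intended\<close>

lemma ConI:
  assumes "\<theta> \<subseteq> Carrier M \<times> Carrier M"
    and "\<And>x. x \<in> Carrier M \<Longrightarrow> (x, x) \<in> \<theta>"
    and "\<And>x y. (x, y) \<in> \<theta> \<Longrightarrow> (y, x) \<in> \<theta>"
    and "\<And>x y z. (x, y) \<in> \<theta> \<Longrightarrow> (y, z) \<in> \<theta> \<Longrightarrow> (x, z) \<in> \<theta>"
    and "\<And>f xs ys. length xs = ar f \<Longrightarrow> list_all2 (\<lambda>x y. (x, y) \<in> \<theta>) xs ys \<Longrightarrow>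
           (Op M f xs, Op M f ys) \<in> \<theta>"
  shows "\<theta> \<in> Con ar M"
  using assms unfolding Con_def equiv_def refl_on_def sym_def trans_def by blast

lemma ConD:
  assumes "\<theta> \<in> Con ar M"
  shows Con_sub: "\<theta> \<subseteq> Carrier M \<times> Carrier M"
    and Con_refl: "\<And>x. x \<in> Carrier M \<Longrightarrow> (x, x) \<in> \<theta>"
    and Con_sym: "\<And>x y. (x, y) \<in> \<theta> \<Longrightarrow> (y, x) \<in> \<theta>"
    and Con_trans: "\<And>x y z. (x, y) \<in> \<theta> \<Longrightarrow> (y, z) \<in> \<theta> \<Longrightarrow> (x, z) \<in> \<theta>"
    and Con_Op: "\<And>f xs ys. length xs = ar f \<Longrightarrow> list_all2 (\<lambda>x y. (x, y) \<in> \<theta>) xs ys \<Longrightarrow>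
           (Op M f xs, Op M f ys) \<in> \<theta>"
  using assms unfolding Con_def equiv_def refl_on_def sym_def trans_def by blast+

lemma algebra_Op:
  "algebra ar M \<Longrightarrow> length xs = ar f \<Longrightarrow> set xs \<subseteq> Carrier M \<Longrightarrow> Op M f xs \<in> Carrier M"
  by (simp add: algebra_def)

lemma list_all2_sub:
  assumes "list_all2 (\<lambda>x y. (x, y) \<in> \<theta>) xs ys" "\<theta> \<subseteq> S \<times> S"
  shows "length ys = length xs" "set xs \<subseteq> S" "set ys \<subseteq> S"
  using assms unfolding list_all2_conv_all_nth set_conv_nth by auto

lemma Nabla_Con: "algebra ar M \<Longrightarrow> Nabla M \<in> Con ar M"
  unfolding Nabla_def
proof (rule ConI)
  fix f xs ys
  assume M: "algebra ar M" and l: "length xs = ar f"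
    and *: "list_all2 (\<lambda>x y. (x, y) \<in> Carrier M \<times> Carrier M) xs ys"
  note s = list_all2_sub[OF * subset_refl]
  show "(Op M f xs, Op M f ys) \<in> Carrier M \<times> Carrier M"
    using M l s by (simp add: algebra_Op)
qed auto

lemma Con_Inter:
  assumes "S \<subseteq> Con ar M" "S \<noteq> {}"
  shows "\<Inter>S \<in> Con ar M"
proof (rule ConI)
  show "\<Inter>S \<subseteq> Carrier M \<times> Carrier M" using assms Con_sub by blast
next
  fix f xs ys
  assume l: "length xs = ar f" and *: "list_all2 (\<lambda>x y. (x, y) \<in> \<Inter>S) xs ys"
  have "list_all2 (\<lambda>x y. (x, y) \<in> \<theta>) xs ys" if "\<theta> \<in> S" for \<theta>
    by (rule list_all2_mono[OF *]) (use that in blast)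
  then show "(Op M f xs, Op M f ys) \<in> \<Inter>S" using l assms Con_Op[of _ ar M] by blast
next
  fix x y z assume "(x, y) \<in> \<Inter>S" "(y, z) \<in> \<Inter>S"
  then show "(x, z) \<in> \<Inter>S" using assms Con_trans[of _ ar M x y z] by blast
qed (use assms Con_refl[of _ ar M] Con_sym[of _ ar M] in blast)+

lemma Con_Int: "\<alpha> \<in> Con ar M \<Longrightarrow> \<beta> \<in> Con ar M \<Longrightarrow> \<alpha> \<inter> \<beta> \<in> Con ar M"
  using Con_Inter[of "{\<alpha>, \<beta>}" ar M] by simp

lemma con_join_Con:
  assumes "algebra ar M" "\<alpha> \<in> Con ar M" "\<beta> \<in> Con ar M"
  shows "con_join ar M \<alpha> \<beta> \<in> Con ar M"
proof -
  have "\<alpha> \<union> \<beta> \<subseteq> Nabla M" using assms(2,3) Con_sub unfolding Nabla_def by blast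
  then show ?thesis unfolding con_join_def hull_def
    by (intro Con_Inter) (use Nabla_Con[OF assms(1)] in auto)
qed

lemma con_join_upper: "\<alpha> \<subseteq> con_join ar M \<alpha> \<beta>" "\<beta> \<subseteq> con_join ar M \<alpha> \<beta>"
  unfolding con_join_def hull_def by auto

lemma con_join_least:
  "\<theta> \<in> Con ar M \<Longrightarrow> \<alpha> \<subseteq> \<theta> \<Longrightarrow> \<beta> \<subseteq> \<theta> \<Longrightarrow> con_join ar M \<alpha> \<beta> \<subseteq> \<theta>"
  unfolding con_join_def hull_def by auto

lemma eval_closed:
  assumes "algebra ar M" "wf_trm ar t" "range v \<subseteq> Carrier M"
  shows "eval M v t \<in> Carrier M"
  using assms(2)
proof (induction t)
  case (App f ts)
  then show ?case using assms(1)
    by (auto simp: list_all_iff intro!: algebra_Op)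
qed (use assms in auto)

lemma eval_morphism:
  assumes "algebra ar A" "morphism ar A B h" "wf_trm ar t" "range v \<subseteq> Carrier A"
  shows "h (eval A v t) = eval B (h \<circ> v) t"
  using assms(3)
proof (induction t)
  case (App f ts)
  have "set (map (eval A v) ts) \<subseteq> Carrier A"
    using App.prems assms(1,4) by (auto simp: list_all_iff eval_closed)
  then have "h (eval A v (App f ts)) = Op B f (map h (map (eval A v) ts))"
    using App.prems assms(2) by (simp add: morphism_def)
  also have "map h (map (eval A v) ts) = map (eval B (h \<circ> v)) ts"
    unfolding map_map by (rule map_cong[OF refl]) (use App in \<open>simp add: list_all_iff comp_def\<close>)
  finally show ?case by (simp add: comp_def)
qed simp

text \<open>The commutator is indeed the least congruence satisfying the term condition.\<close>

lemma commutator_least: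
  assumes "algebra ar M" "\<alpha> \<in> Con ar M" "\<beta> \<in> Con ar M"
  shows "commutator ar M \<alpha> \<beta> \<in> Con ar M"
    and "centralizes ar M \<alpha> \<beta> (commutator ar M \<alpha> \<beta>)"
    and "\<And>\<delta>. \<delta> \<in> Con ar M \<Longrightarrow> centralizes ar M \<alpha> \<beta> \<delta> \<Longrightarrow> commutator ar M \<alpha> \<beta> \<subseteq> \<delta>"
proof -
  have "centralizes ar M \<alpha> \<beta> (Nabla M)"
    unfolding centralizes_def
  proof (intro allI impI)
    fix t :: "('a, nat + nat) trm" and a b c d :: "nat \<Rightarrow> 'b"
    assume *: "wf_trm ar t \<and> (\<forall>i. (a i, b i) \<in> \<alpha>) \<and> (\<forall>j. (c j, d j) \<in> \<beta>)"
    then have "b i \<in> Carrier M" "c i \<in> Carrier M" "d i \<in> Carrier M" for i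
      using Con_sub[OF assms(2)] Con_sub[OF assms(3)] by blast+
    then show "(eval M (case_sum b c) t, eval M (case_sum b d) t) \<in> Nabla M"
      unfolding Nabla_def using * assms(1)
      by (auto intro!: eval_closed split: sum.splits)
  qed
  then show "commutator ar M \<alpha> \<beta> \<in> Con ar M"
    unfolding commutator_def using Nabla_Con[OF assms(1)] by (intro Con_Inter) auto
  show "centralizes ar M \<alpha> \<beta> (commutator ar M \<alpha> \<beta>)"
    unfolding centralizes_def commutator_def by blast
  show "\<And>\<delta>. \<delta> \<in> Con ar M \<Longrightarrow> centralizes ar M \<alpha> \<beta> \<delta> \<Longrightarrow> commutator ar M \<alpha> \<beta> \<subseteq> \<delta>"
    unfolding commutator_def by blast
qed

lemma pullback_Con:
  assumes "algebra ar A" "morphism ar A B h" "\<theta> \<in> Con ar B"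
  shows "pullback A h \<theta> \<in> Con ar A"
proof (rule ConI)
  fix f xs ys
  assume l: "length xs = ar f" and *: "list_all2 (\<lambda>x y. (x, y) \<in> pullback A h \<theta>) xs ys"
  have sub: "pullback A h \<theta> \<subseteq> Carrier A \<times> Carrier A" by (auto simp: pullback_def)
  note s = list_all2_sub[OF * sub]
  have "list_all2 (\<lambda>x y. (x, y) \<in> \<theta>) (map h xs) (map h ys)"
    unfolding list_all2_map1 list_all2_map2
    by (rule list_all2_mono[OF *]) (auto simp: pullback_def)
  then have "(Op B f (map h xs), Op B f (map h ys)) \<in> \<theta>"
    using Con_Op[OF assms(3)] l by simp
  then show "(Op A f xs, Op A f ys) \<in> pullback A h \<theta>"
    using s l assms(1,2) by (auto simp: pullback_def morphism_def algebra_Op)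
next
  fix x y z assume "(x, y) \<in> pullback A h \<theta>" "(y, z) \<in> pullback A h \<theta>"
  then show "(x, z) \<in> pullback A h \<theta>"
    using Con_trans[OF assms(3), of "h x" "h y" "h z"] by (auto simp: pullback_def)
next
  fix x assume "x \<in> Carrier A"
  moreover from this have "h x \<in> Carrier B" using assms(2) by (auto simp: morphism_def)
  ultimately show "(x, x) \<in> pullback A h \<theta>"
    using Con_refl[OF assms(3)] by (simp add: pullback_def)
qed (auto simp: pullback_def intro: Con_sym[OF assms(3)])

lemma pullback_mono: "\<theta> \<subseteq> \<theta>' \<Longrightarrow> pullback A h \<theta> \<subseteq> pullback A h \<theta>'"
  by (auto simp: pullback_def)

text \<open>Being related by a join only depends on countably many elements.\<close>

lemma con_join_countable:
  fixes M :: "('f, 'a) ualg"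
  assumes M: "algebra ar M" and \<alpha>: "\<alpha> \<in> Con ar M" and \<beta>: "\<beta> \<in> Con ar M"
    and xy: "(x, y) \<in> con_join ar M \<alpha> \<beta>"
  shows "\<exists>X. countable X \<and> X \<subseteq> Carrier M \<and>
    (\<forall>(N :: ('f, 'u) ualg) e p q. algebra ar N \<and> morphism ar N M e \<and> X \<subseteq> e ` Carrier N \<and>
       p \<in> Carrier N \<and> q \<in> Carrier N \<and> e p = x \<and> e q = y \<longrightarrow>
       (p, q) \<in> con_join ar N (pullback N e \<alpha>) (pullback N e \<beta>))"
proof -
  define P where "P X x y \<longleftrightarrow>
    (\<forall>(N :: ('f, 'u) ualg) e p q. algebra ar N \<and> morphism ar N M e \<and> X \<subseteq> e ` Carrier N \<and>
       p \<in> Carrier N \<and> q \<in> Carrier N \<and> e p = x \<and> e q = y \<longrightarrow>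
       (p, q) \<in> con_join ar N (pullback N e \<alpha>) (pullback N e \<beta>))" for X x y
  define Q where "Q X x y \<longleftrightarrow> countable X \<and> X \<subseteq> Carrier M \<and> P X x y" for X x y
  define R where "R = {(x, y) \<in> Carrier M \<times> Carrier M. \<exists>X. Q X x y}"
  have J: "con_join ar N (pullback N e \<alpha>) (pullback N e \<beta>) \<in> Con ar N"
    if "algebra ar N" "morphism ar N M e" for N :: "('f, 'u) ualg" and e
    by (intro con_join_Con pullback_Con[OF that] that \<alpha> \<beta>)
  have PI: "P X x y" if "\<And>(N :: ('f, 'u) ualg) e p q. algebra ar N \<Longrightarrow> morphism ar N M e \<Longrightarrow>
       X \<subseteq> e ` Carrier N \<Longrightarrow>
       p \<in> Carrier N \<Longrightarrow> q \<in> Carrier N \<Longrightarrow> e p = x \<Longrightarrow> e q = y \<Longrightarrow>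
       (p, q) \<in> con_join ar N (pullback N e \<alpha>) (pullback N e \<beta>)" for X x y
    unfolding P_def using that by blast
  have PD: "(p, q) \<in> con_join ar N (pullback N e \<alpha>) (pullback N e \<beta>)"
    if "P X x y" "algebra ar N" "morphism ar N M e" "X \<subseteq> e ` Carrier N"
       "p \<in> Carrier N" "q \<in> Carrier N" "e p = x" "e q = y"
       for X x y p q e and N :: "('f, 'u) ualg"
    using that unfolding P_def by blast
  have base: "P {} x y" if "(x, y) \<in> \<alpha> \<union> \<beta>" for x y
  proof (rule PI)
    fix N :: "('f, 'u) ualg" and e p q
    assume "p \<in> Carrier N" "q \<in> Carrier N" "e p = x" "e q = y"
    then have "(p, q) \<in> pullback N e \<alpha> \<union> pullback N e \<beta>"
      using that by (auto simp: pullback_def)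
    then show "(p, q) \<in> con_join ar N (pullback N e \<alpha>) (pullback N e \<beta>)"
      using con_join_upper[where ar = ar and M = N] by blast
  qed
  have R: "R \<in> Con ar M"
  proof (rule ConI)
    show "R \<subseteq> Carrier M \<times> Carrier M" by (auto simp: R_def)
  next
    fix x assume "x \<in> Carrier M"
    then show "(x, x) \<in> R"
      using base[of x x] Con_refl[OF \<alpha>, of x] by (auto simp: R_def Q_def)
  next
    fix x y assume "(x, y) \<in> R"
    then obtain X where X: "x \<in> Carrier M" "y \<in> Carrier M" "countable X" "X \<subseteq> Carrier M" "P X x y"
      by (auto simp: R_def Q_def)
    have "P X y x"
      by (rule PI) (rule Con_sym[OF J], assumption+, rule PD[OF X(5)])
    then show "(y, x) \<in> R" using X by (auto simp: R_def Q_def)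
  next
    fix x y z assume "(x, y) \<in> R" "(y, z) \<in> R"
    then obtain X Y where X: "x \<in> Carrier M" "y \<in> Carrier M" "z \<in> Carrier M"
      "countable X" "X \<subseteq> Carrier M" "countable Y" "Y \<subseteq> Carrier M" and P: "P X x y" "P Y y z"
      by (auto simp: R_def Q_def)
    have "P (insert y (X \<union> Y)) x z"
    proof (rule PI)
      fix N :: "('f, 'u) ualg" and e p q
      assume N: "algebra ar N" "morphism ar N M e" and s: "insert y (X \<union> Y) \<subseteq> e ` Carrier N"
        and pq: "p \<in> Carrier N" "q \<in> Carrier N" "e p = x" "e q = z"
      from s obtain r where "r \<in> Carrier N" "e r = y" by auto
      then show "(p, q) \<in> con_join ar N (pullback N e \<alpha>) (pullback N e \<beta>)"
        using PD[OF P(1) N, of p r] PD[OF P(2) N, of r q] s pq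
        by (intro Con_trans[OF J[OF N], of p r q]) auto
    qed
    then show "(x, z) \<in> R" using X by (auto simp: R_def Q_def intro!: exI[of _ "insert y (X \<union> Y)"])
  next
    fix f xs ys
    assume l: "length xs = ar f" and *: "list_all2 (\<lambda>x y. (x, y) \<in> R) xs ys"
    have sub: "R \<subseteq> Carrier M \<times> Carrier M" by (auto simp: R_def)
    note s = list_all2_sub[OF * sub]
    have "\<forall>i. \<exists>X. i < length xs \<longrightarrow> Q X (xs ! i) (ys ! i)"
      using * by (auto simp: list_all2_conv_all_nth R_def)
    then obtain X where X: "\<And>i. i < length xs \<Longrightarrow> Q (X i) (xs ! i) (ys ! i)" by metis
    define Y where "Y = set xs \<union> set ys \<union> (\<Union>i<length xs. X i)"
    have Y: "countable Y" "Y \<subseteq> Carrier M"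
      using X s unfolding Y_def Q_def by (auto intro!: countable_UN simp: countable_finite)
    have "P Y (Op M f xs) (Op M f ys)"
    proof (rule PI)
      fix N :: "('f, 'u) ualg" and e p q
      assume N: "algebra ar N" "morphism ar N M e" and sY: "Y \<subseteq> e ` Carrier N"
        and pq: "p \<in> Carrier N" "q \<in> Carrier N" "e p = Op M f xs" "e q = Op M f ys"
      let ?J = "con_join ar N (pullback N e \<alpha>) (pullback N e \<beta>)"
      have "\<forall>z\<in>Y. \<exists>w. w \<in> Carrier N \<and> e w = z" using sY by (auto simp: image_iff)
      then obtain w where w: "\<And>z. z \<in> Y \<Longrightarrow> w z \<in> Carrier N \<and> e (w z) = z" by metis
      have wx: "set (map w xs) \<subseteq> Carrier N" "map e (map w xs) = xs"
        and wy: "set (map w ys) \<subseteq> Carrier N" "map e (map w ys) = ys"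
        using w by (auto simp: Y_def intro!: map_idI)
      have O: "Op N f (map w xs) \<in> Carrier N" "Op N f (map w ys) \<in> Carrier N"
        using algebra_Op[OF N(1), of "map w xs" f] algebra_Op[OF N(1), of "map w ys" f] wx wy l s
        by auto
      have eO: "e (Op N f (map w xs)) = Op M f xs" "e (Op N f (map w ys)) = Op M f ys"
        using N(2)[unfolded morphism_def, THEN conjunct2, rule_format, of "map w xs" f]
          N(2)[unfolded morphism_def, THEN conjunct2, rule_format, of "map w ys" f] wx wy l s
        by (simp_all del: map_map)
      have "list_all2 (\<lambda>x y. (x, y) \<in> ?J) (map w xs) (map w ys)"
        unfolding list_all2_conv_all_nth
      proof (intro conjI allI impI)
        fix i assume "i < length (map w xs)"
        then have i: "i < length xs" "i < length ys" using s by auto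
        have "(w (xs ! i), w (ys ! i)) \<in> ?J"
        proof (rule PD[OF _ N])
          show "P (X i) (xs ! i) (ys ! i)" using X[OF i(1)] by (simp add: Q_def)
          show "X i \<subseteq> e ` Carrier N" using sY i by (auto simp: Y_def)
        qed (use w i in \<open>auto simp: Y_def\<close>)
        then show "(map w xs ! i, map w ys ! i) \<in> ?J" using i by simp
      qed (use s in simp)
      then have 2: "(Op N f (map w xs), Op N f (map w ys)) \<in> ?J"
        using Con_Op[OF J[OF N]] l by simp
      have "e p \<in> Carrier M" "e q \<in> Carrier M" using N(2) pq by (auto simp: morphism_def)
      then have 1: "(p, Op N f (map w xs)) \<in> pullback N e \<alpha>"
        and 3: "(Op N f (map w ys), q) \<in> pullback N e \<alpha>"
        using Con_refl[OF \<alpha>] pq O eO by (auto simp: pullback_def)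
      from 1 2 3 show "(p, q) \<in> ?J"
        by (meson Con_trans[OF J[OF N]] con_join_upper(1) subsetD)
    qed
    then show "(Op M f xs, Op M f ys) \<in> R"
      using Y M l s algebra_Op[OF M, of _ f] by (auto simp: R_def Q_def)
  qed
  have "\<alpha> \<subseteq> R" "\<beta> \<subseteq> R"
    using base Con_sub[OF \<alpha>] Con_sub[OF \<beta>] unfolding R_def Q_def by blast+
  with con_join_least[OF R] xy have "(x, y) \<in> R" by blast
  then show ?thesis unfolding R_def Q_def P_def by blast
qed

text \<open>Every countable set of elements lies in a subalgebra that has a copy in the universe.\<close>

lemma countable_subalgebra_copy:
  fixes M :: "('f, 'a) ualg" and E :: "'f identity set"
  assumes E: "identities ar E" and ME: "M \<in> eq_class ar E"
    and X: "countable X" "X \<subseteq> Carrier M" "X \<noteq> {}"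
  obtains N :: "('f, ('f, nat) trm set) ualg" and e
  where "N \<in> eq_class ar E" "morphism ar N M e" "X \<subseteq> e ` Carrier N"
proof -
  have M: "algebra ar M" using ME by (simp add: eq_class_def)
  define v where "v = from_nat_into X"
  have rv: "range v = X" using X by (simp add: v_def range_from_nat_into)
  define c where "c s = {t. wf_trm ar t \<and> eval M v t = s}" for s
  define S where "S = eval M v ` Collect (wf_trm ar)"
  define e where "e p = eval M v (SOME t. t \<in> p)" for p
  define N :: "('f, ('f, nat) trm set) ualg"
    where "N = \<lparr>Carrier = c ` S, Op = (\<lambda>f ps. c (Op M f (map e ps)))\<rparr>"
  have ec: "e (c s) = s" if s: "s \<in> S" for s
  proof -
    from s obtain t where "t \<in> c s" by (auto simp: S_def c_def)
    then have "(SOME t. t \<in> c s) \<in> c s" by (rule someI)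
    then show ?thesis by (simp add: e_def c_def)
  qed
  have SM: "S \<subseteq> Carrier M" using eval_closed[OF M] rv X by (auto simp: S_def)
  have SO: "Op M f xs \<in> S" if "length xs = ar f" "set xs \<subseteq> S" for f xs
  proof -
    have "xs \<in> lists (eval M v ` Collect (wf_trm ar))" using that by (auto simp: S_def)
    then obtain ts where ts: "ts \<in> lists (Collect (wf_trm ar))" "xs = map (eval M v) ts"
      unfolding lists_image by auto
    then have "wf_trm ar (App f ts)" "eval M v (App f ts) = Op M f xs"
      using that by (auto simp: list_all_iff)
    then show ?thesis unfolding S_def by (metis imageI mem_Collect_eq)
  qed
  have XS: "X \<subseteq> S"
  proof
    fix x assume "x \<in> X"
    then obtain n where "x = v n" using rv by auto
    then have "x = eval M v (Var n)" "wf_trm ar (Var n)" by auto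
    then show "x \<in> S" unfolding S_def by blast
  qed
  have mS: "set (map e ps) \<subseteq> S" if "set ps \<subseteq> Carrier N" for ps
    using that ec by (auto simp: N_def)
  have N: "algebra ar N"
    unfolding algebra_def using X XS mS SO by (fastforce simp: N_def)
  have h: "morphism ar N M e"
    unfolding morphism_def
  proof (intro conjI allI impI)
    show "e ` Carrier N \<subseteq> Carrier M" using ec SM by (auto simp: N_def)
  next
    fix f xs assume *: "length xs = ar f \<and> set xs \<subseteq> Carrier N"
    then have "Op M f (map e xs) \<in> S" using mS SO[of "map e xs" f] by auto
    then show "e (Op N f xs) = Op M f (map e xs)" using ec by (simp add: N_def)
  qed
  have inj: "inj_on e (Carrier N)" using ec by (auto simp: N_def inj_on_def)
  have "N \<in> eq_class ar E"
    unfolding eq_class_def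
  proof (intro CollectI conjI N ballI, clarify)
    fix s t and u :: "nat \<Rightarrow> ('f, nat) trm set"
    assume st: "(s, t) \<in> E" and u: "range u \<subseteq> Carrier N"
    have wf: "wf_trm ar s" "wf_trm ar t" using E st by (auto simp: identities_def)
    have "range (e \<circ> u) \<subseteq> Carrier M" using h u by (auto simp: morphism_def)
    then have "eval M (e \<circ> u) s = eval M (e \<circ> u) t" using ME st by (auto simp: eq_class_def)
    then have "e (eval N u s) = e (eval N u t)"
      using eval_morphism[OF N h _ u] wf by simp
    then show "eval N u s = eval N u t"
      using inj eval_closed[OF N _ u] wf by (auto dest: inj_onD)
  qed
  moreover have "X \<subseteq> e ` Carrier N"
  proof
    fix x assume "x \<in> X"
    then have "x \<in> S" using XS by auto
    then have "x = e (c x)" "c x \<in> Carrier N" using ec by (auto simp: N_def)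
    then show "x \<in> e ` Carrier N" by blast
  qed
  ultimately show thesis using h that by blast
qed

theorem congruence_modular_member:
  fixes M :: "('f, 'a) ualg" and E :: "'f identity set"
  assumes E: "identities ar E" and cm: "congruence_modular ar E" and ME: "M \<in> eq_class ar E"
  shows "modular_Con ar M"
  unfolding modular_Con_def
proof (intro ballI impI)
  fix \<alpha> \<beta> \<gamma> assume \<alpha>: "\<alpha> \<in> Con ar M" and \<beta>: "\<beta> \<in> Con ar M" and \<gamma>: "\<gamma> \<in> Con ar M" and le: "\<alpha> \<subseteq> \<gamma>"
  have M: "algebra ar M" using ME by (simp add: eq_class_def)
  note \<beta>\<gamma> = Con_Int[OF \<beta> \<gamma>]
  show "con_join ar M \<alpha> (\<beta> \<inter> \<gamma>) = con_join ar M \<alpha> \<beta> \<inter> \<gamma>"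
  proof
    show "con_join ar M \<alpha> (\<beta> \<inter> \<gamma>) \<subseteq> con_join ar M \<alpha> \<beta> \<inter> \<gamma>"
      by (rule con_join_least[OF Con_Int[OF con_join_Con[OF M \<alpha> \<beta>] \<gamma>]])
        (use le con_join_upper(1)[of \<alpha> ar M \<beta>] con_join_upper(2)[of \<beta> ar M \<alpha>] in auto)
  next
    show "con_join ar M \<alpha> \<beta> \<inter> \<gamma> \<subseteq> con_join ar M \<alpha> (\<beta> \<inter> \<gamma>)"
    proof clarify
      fix x y assume xy: "(x, y) \<in> con_join ar M \<alpha> \<beta>" "(x, y) \<in> \<gamma>"
      obtain X where X: "countable X" "X \<subseteq> Carrier M"
        and *: "\<And>(N :: ('f, ('f, nat) trm set) ualg) e p q. algebra ar N \<Longrightarrow> morphism ar N M e \<Longrightarrow>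
          X \<subseteq> e ` Carrier N \<Longrightarrow>
          p \<in> Carrier N \<Longrightarrow> q \<in> Carrier N \<Longrightarrow> e p = x \<Longrightarrow> e q = y \<Longrightarrow>
          (p, q) \<in> con_join ar N (pullback N e \<alpha>) (pullback N e \<beta>)"
        using con_join_countable[OF M \<alpha> \<beta> xy(1)] by metis
      have xyM: "x \<in> Carrier M" "y \<in> Carrier M" using xy(2) Con_sub[OF \<gamma>] by auto
      obtain N :: "('f, ('f, nat) trm set) ualg" and e
        where NE: "N \<in> eq_class ar E" and e: "morphism ar N M e"
          and s: "insert x (insert y X) \<subseteq> e ` Carrier N"
        by (rule countable_subalgebra_copy[OF E ME, of "insert x (insert y X)"]) (use X xyM in auto)
      have N: "algebra ar N" using NE by (simp add: eq_class_def)
      note pb = pullback_Con[OF N e]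
      from s obtain p q where pq: "p \<in> Carrier N" "q \<in> Carrier N" "e p = x" "e q = y" by auto
      have "modular_Con ar N" using cm NE by (simp add: congruence_modular_def)
      then have mod: "con_join ar N (pullback N e \<alpha>) (pullback N e \<beta> \<inter> pullback N e \<gamma>) =
          con_join ar N (pullback N e \<alpha>) (pullback N e \<beta>) \<inter> pullback N e \<gamma>"
        using pb[OF \<alpha>] pb[OF \<beta>] pb[OF \<gamma>] pullback_mono[OF le] unfolding modular_Con_def by blast
      have "(p, q) \<in> con_join ar N (pullback N e \<alpha>) (pullback N e \<beta>)"
        using *[OF N e] s pq by blast
      moreover have "(p, q) \<in> pullback N e \<gamma>" using pq xy(2) by (simp add: pullback_def)
      ultimately have "(p, q) \<in> con_join ar N (pullback N e \<alpha>) (pullback N e \<beta> \<inter> pullback N e \<gamma>)"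
        using mod by blast
      also have "\<dots> \<subseteq> pullback N e (con_join ar M \<alpha> (\<beta> \<inter> \<gamma>))"
      proof (rule con_join_least[OF pb[OF con_join_Con[OF M \<alpha> \<beta>\<gamma>]]])
        show "pullback N e \<alpha> \<subseteq> pullback N e (con_join ar M \<alpha> (\<beta> \<inter> \<gamma>))"
          by (intro pullback_mono con_join_upper)
        have "pullback N e (\<beta> \<inter> \<gamma>) \<subseteq> pullback N e (con_join ar M \<alpha> (\<beta> \<inter> \<gamma>))"
          by (intro pullback_mono con_join_upper)
        then show "pullback N e \<beta> \<inter> pullback N e \<gamma> \<subseteq> pullback N e (con_join ar M \<alpha> (\<beta> \<inter> \<gamma>))"
          by (auto simp: pullback_def)
      qed
      finally show "(x, y) \<in> con_join ar M \<alpha> (\<beta> \<inter> \<gamma>)" using pq by (simp add: pullback_def)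
    qed
  qed
qed

end

theory Submission
  imports Defs
begin

text \<open>
  Pullback along a composition is the composite of the pullbacks, which settles Going Up directly;
  Lying Over in the injective case follows from \<open>Ker (g \<circ> f) = Ker f\<close> and \<open>Ker g = Delta\<close>.
  For surjective \<open>f\<close> one pushes a prime \<open>\<phi> \<supseteq> Ker (g \<circ> f)\<close> forward to \<open>B\<close>. The term
  condition for \<open>\<delta>\<close> pulls back to one for \<open>f\<^sup>*\<delta>\<close>, so \<open>[f\<^sup>*\<alpha>, f\<^sup>*\<beta>] \<subseteq> f\<^sup>*[\<alpha>, \<beta>]\<close>, and this makes
  the pushforward prime.
\<close>

text \<open>\<open>pullback B g\<close> also demands membership in \<open>Carrier B\<close>; the
  assumption makes this automatic for images under \<open>f\<close>.\<close>

lemma pullback_comp: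
  assumes "f ` Carrier A \<subseteq> Carrier B"
  shows "pullback A (g \<circ> f) \<psi> = pullback A f (pullback B g \<psi>)"
  using assms by (auto simp: pullback_def)

lemma morphism_comp:
  assumes "morphism ar A B f" "morphism ar B C g"
  shows "morphism ar A C (g \<circ> f)"
  unfolding morphism_def
proof (intro conjI allI impI)
  show "(g \<circ> f) ` Carrier A \<subseteq> Carrier C"
    using assms unfolding morphism_def by fastforce
next
  fix h xs assume *: "length xs = ar h \<and> set xs \<subseteq> Carrier A"
  then have "set (map f xs) \<subseteq> Carrier B" using assms(1) by (auto simp: morphism_def)
  then have "g (Op B h (map f xs)) = Op C h (map g (map f xs))"
    using assms(2) * by (simp add: morphism_def del: map_map)
  then show "(g \<circ> f) (Op A h xs) = Op C h (map (g \<circ> f) xs)"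
    using assms(1) * by (simp add: morphism_def)
qed

text \<open>Homomorphisms commute with term evaluation, so applying \<open>f\<close> to an instance
  of the term condition in A gives an instance in B with the same term.\<close>

lemma centralizes_pullback:
  assumes A: "algebra ar A" and f: "morphism ar A B f" and \<delta>: "centralizes ar B \<alpha> \<beta> \<delta>"
  shows "centralizes ar A (pullback A f \<alpha>) (pullback A f \<beta>) (pullback A f \<delta>)"
  unfolding centralizes_def
proof (intro allI impI)
  fix t :: "('a, nat + nat) trm" and a b c d
  assume *: "wf_trm ar t \<and> (\<forall>i. (a i, b i) \<in> pullback A f \<alpha>) \<and> (\<forall>j. (c j, d j) \<in> pullback A f \<beta>)"
    and ac: "(eval A (case_sum a c) t, eval A (case_sum a d) t) \<in> pullback A f \<delta>"
  \<comment> \<open>Only pairs over \<open>Carrier A\<close> occur in a pullback, so all four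
    valuations take values where \<open>eval_morphism\<close> and \<open>eval_closed\<close>
    apply.\<close>
  then have in_A: "range (case_sum x y) \<subseteq> Carrier A" if "x \<in> {a, b}" "y \<in> {c, d}" for x y
    using that by (auto simp: pullback_def split: sum.splits)
  have ev: "f (eval A (case_sum x y) t) = eval B (case_sum (f \<circ> x) (f \<circ> y)) t"
    if "x \<in> {a, b}" "y \<in> {c, d}" for x y
    using eval_morphism[OF A f _ in_A[OF that]] * by (simp add: o_case_sum)
  have "(eval B (case_sum (f \<circ> a) (f \<circ> c)) t, eval B (case_sum (f \<circ> a) (f \<circ> d)) t) \<in> \<delta>"
    using ac by (simp add: pullback_def ev)
  moreover have "wf_trm ar t \<and> (\<forall>i. ((f \<circ> a) i, (f \<circ> b) i) \<in> \<alpha>) \<and> (\<forall>j. ((f \<circ> c) j, (f \<circ> d) j) \<in> \<beta>)"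
    using * by (simp add: pullback_def)
  ultimately have "(eval B (case_sum (f \<circ> b) (f \<circ> c)) t, eval B (case_sum (f \<circ> b) (f \<circ> d)) t) \<in> \<delta>"
    using \<delta> unfolding centralizes_def by blast
  then show "(eval A (case_sum b c) t, eval A (case_sum b d) t) \<in> pullback A f \<delta>"
    using * in_A by (auto simp: pullback_def ev intro!: eval_closed[OF A])
qed

text \<open>The right-hand side is a congruence of A meeting the term condition for the two
  pullbacks, and the commutator is the least such congruence.\<close>

lemma commutator_pullback:
  assumes A: "algebra ar A" and B: "algebra ar B" and f: "morphism ar A B f"
    and \<alpha>: "\<alpha> \<in> Con ar B" and \<beta>: "\<beta> \<in> Con ar B"
  shows "commutator ar A (pullback A f \<alpha>) (pullback A f \<beta>) \<subseteq> pullback A f (commutator ar B \<alpha> \<beta>)"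
  using pullback_Con[OF A f] centralizes_pullback[OF A f] commutator_least(1,2)[OF B \<alpha> \<beta>] \<alpha> \<beta>
  by (intro commutator_least(3)[OF A]) blast+

text \<open>The bare image, with no congruence generated from it: for \<open>f\<close> onto B and
  \<phi> a congruence above the kernel it is already a congruence.\<close>

definition pushforward :: "('a \<Rightarrow> 'b) \<Rightarrow> 'a rel \<Rightarrow> 'b rel" where
  "pushforward f \<phi> = map_prod f f ` \<phi>"

lemma pushforward_subset_iff:
  assumes "\<phi> \<subseteq> Carrier A \<times> Carrier A"
  shows "pushforward f \<phi> \<subseteq> \<psi> \<longleftrightarrow> \<phi> \<subseteq> pullback A f \<psi>"
  using assms by (fastforce simp: pushforward_def pullback_def)

lemma pushforward_pullback:
  assumes "f ` Carrier A = Carrier B" "\<psi> \<subseteq> Carrier B \<times> Carrier B"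
  shows "pushforward f (pullback A f \<psi>) = \<psi>"
proof
  show "\<psi> \<subseteq> pushforward f (pullback A f \<psi>)"
  proof clarify
    fix u v assume uv: "(u, v) \<in> \<psi>"
    then obtain x y where "x \<in> Carrier A" "y \<in> Carrier A" "u = f x" "v = f y"
      using assms by blast
    with uv show "(u, v) \<in> pushforward f (pullback A f \<psi>)"
      by (force simp: pushforward_def pullback_def)
  qed
qed (auto simp: pushforward_def pullback_def)

text \<open>A congruence containing the kernel is saturated: replacing an entry of a pair by another
  element with the same image stays inside \<phi>.\<close>

lemma pullback_pushforward:
  assumes f: "morphism ar A B f" and \<phi>: "\<phi> \<in> Con ar A" and ker: "Ker A B f \<subseteq> \<phi>"
  shows "pullback A f (pushforward f \<phi>) = \<phi>"
proof
  show "\<phi> \<subseteq> pullback A f (pushforward f \<phi>)"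
    using pushforward_subset_iff[OF Con_sub[OF \<phi>]] by blast
next
  have k: "(x, y) \<in> \<phi>" if "x \<in> Carrier A" "y \<in> Carrier A" "f x = f y" for x y
  proof -
    have "(x, y) \<in> Ker A B f"
      using that f by (auto simp: Ker_def pullback_def Delta_def morphism_def)
    then show ?thesis using ker by blast
  qed
  show "pullback A f (pushforward f \<phi>) \<subseteq> \<phi>"
  proof clarify
    fix x y assume "(x, y) \<in> pullback A f (pushforward f \<phi>)"
    then obtain x' y' where *: "x \<in> Carrier A" "y \<in> Carrier A" "(x', y') \<in> \<phi>" "f x = f x'" "f y = f y'"
      by (auto simp: pullback_def pushforward_def)
    \<comment> \<open>The chain x, x', y', y is linked by \<phi>; its outer links come from the
      kernel.\<close>
    then have "(x, x') \<in> \<phi>" "(y', y) \<in> \<phi>" using k Con_sub[OF \<phi>] by auto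
    then show "(x, y) \<in> \<phi>" using *(3) Con_trans[OF \<phi>] by blast
  qed
qed

text \<open>Elements of B are lifted to A by surjectivity, and the congruence laws are checked
  there.\<close>

lemma pushforward_Con:
  assumes f: "morphism ar A B f" and sf: "f ` Carrier A = Carrier B"
    and \<phi>: "\<phi> \<in> Con ar A" and ker: "Ker A B f \<subseteq> \<phi>"
  shows "pushforward f \<phi> \<in> Con ar B"
proof -
  let ?\<psi> = "pushforward f \<phi>"
  \<comment> \<open>Membership is independent of the chosen preimages. Transitivity depends on this,
    since the two given pairs may come from different preimages of the middle element.\<close>
  have iff: "(f x, f y) \<in> ?\<psi> \<longleftrightarrow> (x, y) \<in> \<phi>" if "x \<in> Carrier A" "y \<in> Carrier A" for x y
    using pullback_pushforward[OF f \<phi> ker] that by (auto simp: pullback_def)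
  have sub: "?\<psi> \<subseteq> Carrier B \<times> Carrier B"
    using Con_sub[OF \<phi>] sf by (auto simp: pushforward_def)
  show ?thesis
  proof (rule ConI)
    fix x assume "x \<in> Carrier B"
    then obtain u where "u \<in> Carrier A" "x = f u" using sf by blast
    then show "(x, x) \<in> ?\<psi>" using iff Con_refl[OF \<phi>] by blast
  next
    fix x y assume "(x, y) \<in> ?\<psi>"
    then show "(y, x) \<in> ?\<psi>" using Con_sym[OF \<phi>] by (force simp: pushforward_def)
  next
    fix x y z assume *: "(x, y) \<in> ?\<psi>" "(y, z) \<in> ?\<psi>"
    then have "x \<in> f ` Carrier A" "y \<in> f ` Carrier A" "z \<in> f ` Carrier A" using sub sf by auto
    then show "(x, z) \<in> ?\<psi>" using * iff Con_trans[OF \<phi>] by blast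
  next
    fix h xs ys assume l: "length xs = ar h" and *: "list_all2 (\<lambda>x y. (x, y) \<in> ?\<psi>) xs ys"
    note s = list_all2_sub[OF * sub]
    have "xs \<in> lists (f ` Carrier A)" "ys \<in> lists (f ` Carrier A)" using s sf by auto
    then obtain us vs where u: "set us \<subseteq> Carrier A" "xs = map f us"
      and v: "set vs \<subseteq> Carrier A" "ys = map f vs"
      unfolding lists_image by auto
    have "list_all2 (\<lambda>x y. (x, y) \<in> \<phi>) us vs"
      using * u v iff by (auto simp: list_all2_conv_all_nth subset_iff)
    then have "(Op A h us, Op A h vs) \<in> \<phi>" using Con_Op[OF \<phi>] l u by simp
    then have "(f (Op A h us), f (Op A h vs)) \<in> ?\<psi>" by (force simp: pushforward_def)
    then show "(Op B h xs, Op B h ys) \<in> ?\<psi>"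
      using f u v l s by (simp add: morphism_def)
  qed (rule sub)
qed

text \<open>A commutator inclusion in B is pulled back to A, decided there by primeness of \<phi>,
  and the resulting inclusion is pushed forward again.\<close>

lemma pushforward_Spec:
  assumes A: "algebra ar A" and B: "algebra ar B"
    and f: "morphism ar A B f" and sf: "f ` Carrier A = Carrier B"
    and \<phi>: "\<phi> \<in> Spec ar A" and ker: "Ker A B f \<subseteq> \<phi>"
  shows "pushforward f \<phi> \<in> Spec ar B"
proof -
  have \<phi>C: "\<phi> \<in> Con ar A" using \<phi> by (simp add: Spec_def)
  note pp = pullback_pushforward[OF f \<phi>C ker]
  have "pushforward f \<phi> \<noteq> Nabla B"
  proof
    assume "pushforward f \<phi> = Nabla B"
    \<comment> \<open>Pulling back the full relation on B yields the full relation on A.\<close>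
    then have "\<phi> = Nabla A" using pp sf by (auto simp: pullback_def Nabla_def)
    then show False using \<phi> by (simp add: Spec_def)
  qed
  moreover have "\<alpha> \<subseteq> pushforward f \<phi> \<or> \<beta> \<subseteq> pushforward f \<phi>"
    if \<alpha>: "\<alpha> \<in> Con ar B" and \<beta>: "\<beta> \<in> Con ar B" and le: "commutator ar B \<alpha> \<beta> \<subseteq> pushforward f \<phi>"
    for \<alpha> \<beta>
  proof -
    have "commutator ar A (pullback A f \<alpha>) (pullback A f \<beta>) \<subseteq> \<phi>"
      using commutator_pullback[OF A B f \<alpha> \<beta>] pullback_mono[OF le, of A f] pp by blast
    then have "pullback A f \<alpha> \<subseteq> \<phi> \<or> pullback A f \<beta> \<subseteq> \<phi>"
      using \<phi> pullback_Con[OF A f] \<alpha> \<beta> by (simp add: Spec_def)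
    \<comment> \<open>Surjectivity recovers \<theta> as the image of its own pullback.\<close>
    moreover have "\<theta> \<subseteq> pushforward f \<phi>" if "\<theta> \<in> Con ar B" "pullback A f \<theta> \<subseteq> \<phi>" for \<theta>
      using image_mono[OF that(2), of "map_prod f f"] pushforward_pullback[OF sf Con_sub[OF that(1)]]
      by (simp add: pushforward_def)
    ultimately show ?thesis using \<alpha> \<beta> by blast
  qed
  ultimately show ?thesis using pushforward_Con[OF f sf \<phi>C ker] by (auto simp: Spec_def)
qed

lemma GU_comp:
  assumes im: "f ` Carrier A \<subseteq> Carrier B" and g: "admissible ar B C g"
    and GU: "GU ar A B f" "GU ar B C g"
  shows "GU ar A C (g \<circ> f)"
  unfolding GU_def
proof (intro ballI impI, elim conjE)
  fix \<phi> \<psi> \<chi> assume *: "\<phi> \<in> Spec ar A" "\<psi> \<in> Spec ar A" "\<chi> \<in> Spec ar C" "\<phi> \<subseteq> \<psi>"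
    and "pullback A (g \<circ> f) \<chi> = \<phi>"
  then have eq: "pullback A f (pullback B g \<chi>) = \<phi>" by (simp add: pullback_comp[OF im])
  have g\<chi>: "pullback B g \<chi> \<in> Spec ar B" using g * by (simp add: admissible_def)
  \<comment> \<open>Go up along \<open>f\<close> starting from the pullback of \<chi> to B, then
    along \<open>g\<close> starting from \<chi> itself.\<close>
  obtain \<psi>1 where 1: "\<psi>1 \<in> Spec ar B" "pullback B g \<chi> \<subseteq> \<psi>1" "pullback A f \<psi>1 = \<psi>"
    using GU(1) * g\<chi> eq unfolding GU_def by blast
  obtain \<psi>2 where "\<psi>2 \<in> Spec ar C" "\<chi> \<subseteq> \<psi>2" "pullback B g \<psi>2 = \<psi>1"
    using GU(2) * g\<chi> 1 unfolding GU_def by blast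
  with 1 show "\<exists>\<psi>1\<in>Spec ar C. \<chi> \<subseteq> \<psi>1 \<and> pullback A (g \<circ> f) \<psi>1 = \<psi>"
    by (auto simp: pullback_comp[OF im])
qed

lemma LO_comp_surj:
  assumes A: "algebra ar A" and B: "algebra ar B"
    and f: "morphism ar A B f" and g: "morphism ar B C g"
    and sf: "f ` Carrier A = Carrier B" and LO: "LO ar B C g"
  shows "LO ar A C (g \<circ> f)"
  unfolding LO_def
proof (intro ballI impI)
  fix \<phi> assume \<phi>: "\<phi> \<in> Spec ar A" and ker: "Ker A C (g \<circ> f) \<subseteq> \<phi>"
  have im: "f ` Carrier A \<subseteq> Carrier B" using sf by simp
  have \<phi>C: "\<phi> \<in> Con ar A" using \<phi> by (simp add: Spec_def)
  have "Ker A B f \<subseteq> Ker A C (g \<circ> f)"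
    using g by (auto simp: Ker_def pullback_def Delta_def morphism_def)
  then have kf: "Ker A B f \<subseteq> \<phi>" using ker by blast
  \<comment> \<open>Pushing this kernel forward gives back \<open>Ker B C g\<close>, so the
    pushed-forward prime lies above it, as LO for \<open>g\<close> requires.\<close>
  have "Ker A C (g \<circ> f) = pullback A f (Ker B C g)" by (simp add: Ker_def pullback_comp[OF im])
  then have "pushforward f (pullback A f (Ker B C g)) \<subseteq> pushforward f \<phi>"
    using ker unfolding pushforward_def by blast
  moreover have "Ker B C g \<subseteq> Carrier B \<times> Carrier B" by (auto simp: Ker_def pullback_def)
  ultimately have "Ker B C g \<subseteq> pushforward f \<phi>" using pushforward_pullback[OF sf] by metis
  then obtain \<chi> where "\<chi> \<in> Spec ar C" "pullback B g \<chi> = pushforward f \<phi>"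
    using LO pushforward_Spec[OF A B f sf \<phi> kf] unfolding LO_def by blast
  then show "\<exists>\<chi>\<in>Spec ar C. pullback A (g \<circ> f) \<chi> = \<phi>"
    using pullback_pushforward[OF f \<phi>C kf] by (metis pullback_comp[OF im])
qed

lemma LO_comp_inj:
  assumes f: "morphism ar A B f" and LO: "LO ar A B f" "LO ar B C g"
    and g: "morphism ar B C g" and inj: "inj_on g (Carrier B)"
  shows "LO ar A C (g \<circ> f)"
  unfolding LO_def
proof (intro ballI impI)
  fix \<phi> assume \<phi>: "\<phi> \<in> Spec ar A" and ker: "Ker A C (g \<circ> f) \<subseteq> \<phi>"
  have im: "f ` Carrier A \<subseteq> Carrier B" using f by (simp add: morphism_def)
  have kg: "Ker B C g = Delta B"
    using g inj by (auto simp: Ker_def pullback_def Delta_def morphism_def inj_on_def)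
  then have "Ker A B f = Ker A C (g \<circ> f)"
    by (simp add: Ker_def pullback_comp[OF im])
  then obtain \<psi> where \<psi>: "\<psi> \<in> Spec ar B" "pullback A f \<psi> = \<phi>"
    using LO(1) \<phi> ker unfolding LO_def by blast
  \<comment> \<open>By injectivity \<open>Ker B C g\<close> is \<open>Delta B\<close>, which lies in
    every congruence, so LO for \<open>g\<close> applies to \<psi>.\<close>
  have "Delta B \<subseteq> \<psi>" using \<psi>(1) Con_refl[of \<psi> ar B] by (auto simp: Spec_def Delta_def)
  then obtain \<chi> where "\<chi> \<in> Spec ar C" "pullback B g \<chi> = \<psi>"
    using LO(2) \<psi> kg unfolding LO_def by blast
  with \<psi> show "\<exists>\<chi>\<in>Spec ar C. pullback A (g \<circ> f) \<chi> = \<phi>"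
    by (auto simp: pullback_comp[OF im])
qed

theorem lemma4p14:
  fixes ar :: "'f \<Rightarrow> nat" and E :: "'f identity set"
    and A :: "('f, 'a) ualg" and B :: "('f, 'b) ualg" and C :: "('f, 'c) ualg"
    and f :: "'a \<Rightarrow> 'b" and g :: "'b \<Rightarrow> 'c"
  assumes "identities ar E" and "congruence_modular ar E"
    and "A \<in> eq_class ar E" and "B \<in> eq_class ar E" and "C \<in> eq_class ar E"
    and "admissible ar A B f" and "admissible ar B C g"
  shows "admissible ar A C (g \<circ> f)
    \<and> (GU ar A B f \<and> GU ar B C g \<longrightarrow> GU ar A C (g \<circ> f))
    \<and> (f ` Carrier A = Carrier B \<and> LO ar B C g \<longrightarrow> LO ar A C (g \<circ> f))
    \<and> (LO ar A B f \<and> LO ar B C g \<and> inj_on g (Carrier B) \<longrightarrow> LO ar A C (g \<circ> f))"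
proof -
  have A: "algebra ar A" and B: "algebra ar B" using assms(3,4) by (auto simp: eq_class_def)
  have f: "morphism ar A B f" and g: "morphism ar B C g" using assms(6,7) by (auto simp: admissible_def)
  have im: "f ` Carrier A \<subseteq> Carrier B" using f by (simp add: morphism_def)
  \<comment> \<open>Primes of C are pulled back in two stages, through B.\<close>
  have "admissible ar A C (g \<circ> f)"
    using assms(6,7) morphism_comp[OF f g] by (simp add: admissible_def pullback_comp[OF im])
  then show ?thesis
    using GU_comp[OF im assms(7)] LO_comp_surj[OF A B f g] LO_comp_inj[OF f _ _ g] by blast
qed

end
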